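(* Let $n \geq 2$ be an integer, let $g : \{1,\dots,n\} \to \mathbb{R}$ be a strictly monotonically increasing function, and let $l^* = \lceil (n+1)/2 \rceil$. For each integer $l$ with $1 \leq l \leq n+1$, let $$D_l = \sum_{d=1}^{l-1} g(d) + \sum_{d=1}^{n+1-l} g(d).$$ Then, as a function of $l \in \{1,\dots,n+1\}$: (1) if $n$ is even, $D_l$ has a single minimum, at $l = l^*$ (i.e. the minimum value is attained exactly at $l = l^*$); (2) if $n$ is odd, $D_l$ has two minima, at $l = l^*$ and $l = l^*+1$ (i.e. the minimum value is attained exactly at these two positions); (3) $D_l$ has two identical maxima, at $l = 1$ and $l = n+1$ (i.e. $D_1 = D_{n+1}$ and the maximum value is attained exactly at these two positions); (4) if $n$ is even, $D_l$ is strictly monotonically decreasing for integers $l \in [1, l^*]$ and strictly monotonically increasing for integers $l \in [l^*, n+1]$; (5) if $n$ is odd, $D_l$ is strictly monotonically decreasing for integers $l \in [1, l^*]$ and strictly monotonically increasing for integers $l \in [l^*+1, n+1]$.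
   Context: A head and its $n$ dependents occupy the positions $1,\dots,n+1$ of a sequence, with the head at position $l$. The cost of a dependency of length $d$ (the absolute difference of the positions of the head and the dependent) is $g(d)$, and $D_l$ is the total cost of the $n$ dependencies, $D_l = \sum_{i=1}^{l-1} g(l-i) + \sum_{i=l+1}^{n+1} g(i-l)$, which is the expression used in the claim. Empty sums are $0$; $g$ need not be positive and no value $g(0)$ is needed. $\lceil x \rceil$ denotes the smallest integer not less than $x$. *)

theory Defs
  imports Complex_Main
begin

text \<open>
  Total cost of a head at position \<open>l \<in> {1..n+1}\<close> with \<open>n\<close> dependents on the remaining
  positions: the \<open>l - 1\<close> dependents before the head lie at distances \<open>1, \<dots>, l - 1\<close>, the
  \<open>n + 1 - l\<close> dependents after it at distances \<open>1, \<dots>, n + 1 - l\<close>.  Only the values of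
  \<open>g\<close> on \<open>{1..n}\<close> matter as long as \<open>1 \<le> l \<le> n + 1\<close>; outside that range the natural-number
  subtractions truncate and the value is meaningless.
\<close>

definition total_cost :: "(nat \<Rightarrow> real) \<Rightarrow> nat \<Rightarrow> nat \<Rightarrow> real" where
  "total_cost g n l = (\<Sum>d = 1..l - 1. g d) + (\<Sum>d = 1..n + 1 - l. g d)"

end

theory Submission
  imports Defs
begin

text \<open>
  Moving the head from \<open>l\<close> to \<open>l + 1\<close> changes the cost by \<open>g l - g (n + 1 - l)\<close>, which is
  negative as long as \<open>2 l \<le> n\<close>. The cost is moreover symmetric under the reflection
  \<open>l \<mapsto> n + 2 - l\<close>, so the behaviour on the first half determines everything.
\<close>

lemma total_cost_reflect:
  assumes "1 \<le> l" "l \<le> n + 1"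
  shows "total_cost g n (n + 2 - l) = total_cost g n l"
proof -
  have "n + 2 - l - 1 = n + 1 - l" "n + 1 - (n + 2 - l) = l - 1"
    using assms by auto
  then show ?thesis
    by (simp add: total_cost_def add.commute)
qed

lemma total_cost_Suc:
  assumes "1 \<le> l" "l \<le> n"
  shows "total_cost g n (Suc l) = total_cost g n l + g l - g (n + 1 - l)"
proof -
  obtain k where k: "l = Suc k" using assms by (cases l) auto
  \<comment> \<open>With \<open>l = Suc k\<close> and \<open>n = l + j\<close> the truncated
    subtractions disappear: the first sum gains its term at \<open>l\<close>, the second loses its
    term at \<open>n + 1 - l = Suc j\<close>.\<close>
  obtain j where j: "n = l + j" using assms le_Suc_ex by blast
  show ?thesis unfolding total_cost_def k j by simp
qed

lemma total_cost_strict_antimono: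
  assumes "strict_mono_on {1..n} g"
  shows "strict_antimono_on {1..n div 2 + 1} (total_cost g n)"
proof (rule monotone_onI)
  have Suc_less: "total_cost g n (Suc i) < total_cost g n i" if "1 \<le> i" "i \<le> n div 2" for i
  proof -
    \<comment> \<open>From \<open>2 * i \<le> n\<close> follows \<open>i < n + 1 - i\<close>, and
      both arguments lie in \<open>{1..n}\<close>.\<close>
    have "g i < g (n + 1 - i)"
      using that by (intro strict_mono_onD[OF assms]) auto
    then show ?thesis using that by (simp add: total_cost_Suc)
  qed
  fix l m assume lm: "l \<in> {1..n div 2 + 1}" "m \<in> {1..n div 2 + 1}" "l < m"
  from \<open>l < m\<close> have "Suc l \<le> m" by simp
  \<comment> \<open>The upper bound on \<open>m\<close> is part of the induction formula, so that
    the step from \<open>k\<close> to \<open>Suc k\<close> still knows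
    \<open>k \<le> n div 2\<close>.\<close>
  then have "m \<le> n div 2 + 1 \<longrightarrow> total_cost g n m < total_cost g n l"
  proof (induction m rule: dec_induct)
    case base
    then show ?case using Suc_less[of l] lm by simp
  next
    case (step k)
    then show ?case using Suc_less[of k] lm by simp
  qed
  then show "total_cost g n m < total_cost g n l" using lm by simp
qed

text \<open>The reflection carries this interval onto \<open>{1..n div 2 + 1}\<close> and reverses
  the order, so descent there becomes ascent here.\<close>

lemma total_cost_strict_mono:
  assumes "strict_mono_on {1..n} g"
  shows "strict_mono_on {n + 1 - n div 2..n + 1} (total_cost g n)"
proof (rule strict_mono_onI)
  fix l m assume lm: "l \<in> {n + 1 - n div 2..n + 1}" "m \<in> {n + 1 - n div 2..n + 1}" "l < m"
  have "total_cost g n (n + 2 - l) < total_cost g n (n + 2 - m)"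
    using lm by (intro monotone_onD[OF total_cost_strict_antimono[OF assms]]) auto
  then show "total_cost g n l < total_cost g n m"
    using lm total_cost_reflect[of l n g] total_cost_reflect[of m n g] by simp
qed

text \<open>Folding along the reflection reduces comparisons of costs to the first half. The
  disjunction records where \<open>l\<close> came from, so that positions excluded for
  \<open>l\<close> can be excluded for \<open>k\<close>.\<close>

lemma total_cost_fold:
  assumes "l \<in> {1..n + 1}"
  obtains k where "k \<in> {1..n div 2 + 1}" "l = k \<or> l = n + 2 - k"
    "total_cost g n l = total_cost g n k"
proof (cases "l \<le> n div 2 + 1")
  case True
  then show ?thesis using assms that[of l] by auto
next
  case False
  then have "n + 2 - l \<in> {1..n div 2 + 1}" "l = n + 2 - (n + 2 - l)"
    using assms unfolding atLeastAtMost_iff by presburger+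
  then show ?thesis using assms that[of "n + 2 - l"] total_cost_reflect[of l n g] by simp
qed

text \<open>The descent on the first half ends at \<open>n div 2 + 1\<close>, and the other element
  is its mirror image. The two coincide for even \<open>n\<close> and are adjacent for odd
  \<open>n\<close>, so one statement serves both parities.\<close>

lemma arg_min_total_cost:
  assumes "strict_mono_on {1..n} g"
  shows "{l. is_arg_min (total_cost g n) (\<lambda>l. l \<in> {1..n + 1}) l} = {n div 2 + 1, n + 1 - n div 2}"
proof -
  let ?D = "total_cost g n" and ?c = "n div 2 + 1"
  have reflect: "?D (n + 1 - n div 2) = ?D ?c"
    using total_cost_reflect[of ?c n g] by simp
  have less: "?D ?c < ?D l" if "l \<in> {1..n + 1}" "l \<noteq> ?c" "l \<noteq> n + 1 - n div 2" for l
  proof -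
    obtain k where k: "k \<in> {1..?c}" "l = k \<or> l = n + 2 - k" "?D l = ?D k"
      using total_cost_fold \<open>l \<in> {1..n + 1}\<close> .
    \<comment> \<open>If \<open>k = ?c\<close>, then \<open>l\<close> would be \<open>?c\<close> or
      its mirror image, both of which are excluded.\<close>
    then have "k < ?c" using that by (cases "k = ?c") auto
    then show ?thesis
      using k monotone_onD[OF total_cost_strict_antimono[OF assms], of k ?c] by simp
  qed
  have c: "?c \<in> {1..n + 1}" "n + 1 - n div 2 \<in> {1..n + 1}" by auto
  have le: "?D ?c \<le> ?D l" if "l \<in> {1..n + 1}" for l
    using less[OF that] reflect by force
  show ?thesis
  proof (intro set_eqI iffI)
    fix l assume "l \<in> {l. is_arg_min ?D (\<lambda>l. l \<in> {1..n + 1}) l}"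
    then have "l \<in> {1..n + 1}" "?D l \<le> ?D ?c"
      using c unfolding is_arg_min_linorder by blast+
    then show "l \<in> {?c, n + 1 - n div 2}" using less[of l] by force
  next
    fix l assume "l \<in> {?c, n + 1 - n div 2}"
    then show "l \<in> {l. is_arg_min ?D (\<lambda>l. l \<in> {1..n + 1}) l}"
      using c le reflect unfolding is_arg_min_linorder by force
  qed
qed

text \<open>An inner position folds to some \<open>k > 1\<close> in the first half, where the cost
  has already dropped below its value at \<open>1\<close>.\<close>

lemma arg_max_total_cost:
  assumes "strict_mono_on {1..n} g"
  shows "{l. is_arg_max (total_cost g n) (\<lambda>l. l \<in> {1..n + 1}) l} = {1, n + 1}"
proof -
  let ?D = "total_cost g n"
  have reflect: "?D (n + 1) = ?D 1"
    using total_cost_reflect[of 1 n g] by simp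
  have less: "?D l < ?D 1" if "l \<in> {1..n + 1}" "l \<noteq> 1" "l \<noteq> n + 1" for l
  proof -
    obtain k where k: "k \<in> {1..n div 2 + 1}" "l = k \<or> l = n + 2 - k" "?D l = ?D k"
      using total_cost_fold \<open>l \<in> {1..n + 1}\<close> .
    then have "1 < k" using that by (cases "k = 1") auto
    then show ?thesis
      using k monotone_onD[OF total_cost_strict_antimono[OF assms], of 1 k] by simp
  qed
  have c: "1 \<in> {1..n + 1}" "n + 1 \<in> {1..n + 1}" by auto
  have le: "?D l \<le> ?D 1" if "l \<in> {1..n + 1}" for l
    using less[OF that] reflect by force
  show ?thesis
  proof (intro set_eqI iffI)
    fix l assume "l \<in> {l. is_arg_max ?D (\<lambda>l. l \<in> {1..n + 1}) l}"
    then have "l \<in> {1..n + 1}" "?D 1 \<le> ?D l"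
      using c unfolding is_arg_max_linorder by blast+
    then show "l \<in> {1, n + 1}" using less[of l] by force
  next
    fix l assume "l \<in> {1, n + 1}"
    then show "l \<in> {l. is_arg_max ?D (\<lambda>l. l \<in> {1..n + 1}) l}"
      using c le reflect unfolding is_arg_max_linorder by force
  qed
qed

theorem theorem2p1:
  fixes n lstar :: nat and g D :: "nat \<Rightarrow> real"
  assumes "n \<ge> 2"
    and "strict_mono_on {1..n} g"
    and "lstar = nat \<lceil>(real n + 1) / 2\<rceil>"
    and "D = total_cost g n"
  shows "(even n \<longrightarrow> {l. is_arg_min D (\<lambda>l. l \<in> {1..n + 1}) l} = {lstar}) \<and>
    (odd n \<longrightarrow> {l. is_arg_min D (\<lambda>l. l \<in> {1..n + 1}) l} = {lstar, lstar + 1}) \<and>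
    (D 1 = D (n + 1) \<and> {l. is_arg_max D (\<lambda>l. l \<in> {1..n + 1}) l} = {1, n + 1}) \<and>
    (even n \<longrightarrow> strict_antimono_on {1..lstar} D \<and> strict_mono_on {lstar..n + 1} D) \<and>
    (odd n \<longrightarrow> strict_antimono_on {1..lstar} D \<and> strict_mono_on {lstar + 1..n + 1} D)"
proof -
  \<comment> \<open>For \<open>n = 2 * k\<close> the ceiling rounds \<open>k + 1/2\<close> up to
    \<open>k + 1\<close>; for \<open>n = 2 * k + 1\<close> the quotient is exactly
    \<open>k + 1\<close>.\<close>
  have "\<lceil>(real n + 1) / 2\<rceil> = int (n div 2 + 1)"
  proof (cases "even n")
    case True
    then show ?thesis by (elim evenE) (auto simp: ceiling_eq_iff)
  next
    case False
    then show ?thesis by (elim oddE) (auto simp: ceiling_eq_iff)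
  qed
  then have lstar: "lstar = n div 2 + 1" using assms(3) by simp
  have even: "n + 1 - n div 2 = lstar" if "even n"
    using that unfolding lstar by (elim evenE) simp
  have odd: "n + 1 - n div 2 = lstar + 1" if "odd n"
    using that unfolding lstar by (elim oddE) simp
  have ends: "D 1 = D (n + 1)"
    using total_cost_reflect[of 1 n g] assms(4) by simp
  note facts = arg_min_total_cost[OF assms(2), folded assms(4) lstar]
    arg_max_total_cost[OF assms(2), folded assms(4)]
    total_cost_strict_antimono[OF assms(2), folded assms(4) lstar]
    total_cost_strict_mono[OF assms(2), folded assms(4)]
  show ?thesis
    using facts even odd ends by (cases "even n") simp_all
qed

end
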